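(* For all integers $k\ge 2$ and $n\ge 3k$, $$r(P_n,P_k)=r(C_n,P_k)=n+\left\lfloor\frac{k}{2}\right\rfloor-1.$$
   Context: For graphs $H_1,H_2$, the Ramsey number $r(H_1,H_2)$ is the smallest positive integer $N$ such that every (finite simple) graph $\Gamma$ on $N$ vertices contains $H_1$ as a (not necessarily induced) subgraph or its complement $\overline{\Gamma}$ contains $H_2$ as a subgraph. $P_m$ and $C_m$ are the path and the cycle on $m$ vertices, respectively. *)

theory Defs
  imports "HOL-Library.Ramsey"
begin

text \<open>A graph is a pair of a vertex set and an edge set, an edge being a two-element set of
  vertices: \<^term>\<open>nsets V 2\<close> is the set of two-element subsets of \<^term>\<open>V\<close>.\<close>

type_synonym 'a graph = "'a set \<times> 'a set set"

definition finite_simple_graph :: "'a graph \<Rightarrow> bool" where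
  "finite_simple_graph G \<longleftrightarrow> finite (fst G) \<and> snd G \<subseteq> nsets (fst G) 2"

definition complement :: "'a graph \<Rightarrow> 'a graph" where
  "complement G = (fst G, nsets (fst G) 2 - snd G)"

text \<open>\<^term>\<open>G\<close> has a subgraph, not necessarily induced, that is isomorphic to \<^term>\<open>H\<close>.\<close>

definition contains_copy :: "'a graph \<Rightarrow> 'b graph \<Rightarrow> bool" where
  "contains_copy G H \<longleftrightarrow>
     (\<exists>f. inj_on f (fst H) \<and> f ` fst H \<subseteq> fst G \<and> (\<forall>e \<in> snd H. f ` e \<in> snd G))"

definition path_graph :: "nat \<Rightarrow> nat graph" where
  "path_graph m = ({..<m}, {{i, Suc i} |i. Suc i < m})"

text \<open>This is the cycle on \<^term>\<open>m\<close> vertices for \<^term>\<open>m \<ge> 3\<close>; for \<^term>\<open>m < 3\<close> the result is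
  not a cycle.\<close>

definition cycle_graph :: "nat \<Rightarrow> nat graph" where
  "cycle_graph m = ({..<m}, {{i, Suc i mod m} |i. i < m})"

text \<open>Every finite graph is isomorphic to one whose vertices are natural numbers, so it suffices
  that \<^term>\<open>\<Gamma>\<close> ranges over those.\<close>

definition ramsey_number :: "'a graph \<Rightarrow> 'b graph \<Rightarrow> nat" where
  "ramsey_number H1 H2 = (LEAST N. 0 < N \<and>
     (\<forall>\<Gamma> :: nat graph. finite_simple_graph \<Gamma> \<and> card (fst \<Gamma>) = N \<longrightarrow>
        contains_copy \<Gamma> H1 \<or> contains_copy (complement \<Gamma>) H2))"

end

theory Submission
  imports Defs
begin

text \<open>Let \<open>m = k div 2\<close> and let \<open>\<Gamma>\<close> have \<open>n + m - 1\<close> vertices, with a complement \<open>G\<close> that contains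
  no \<open>P\<^sub>k\<close>. Depth-first search in \<open>G\<close> keeps a path, hence fewer than \<open>k\<close> vertices, on its stack; when
  there are as many finished as unvisited vertices, these form a complete bipartite subgraph of
  \<open>\<Gamma>\<close>, and so \<open>\<Gamma>\<close> has a cycle of length between \<open>2k + m - 1\<close> and \<open>n\<close>. Such a cycle \<open>C\<close>, if shorter
  than \<open>n\<close>, can be lengthened by one vertex: otherwise, as in the theorem of Chvatal and Erdos, a
  vertex \<open>v\<close> outside \<open>C\<close> and the successors of its \<open>\<Gamma>\<close>-neighbours on \<open>C\<close> form a clique of \<open>G\<close>, so \<open>v\<close>
  has at most \<open>k - 2\<close> such neighbours. Any two of the at least \<open>m\<close> vertices outside \<open>C\<close> then have more
  than \<open>m\<close> common \<open>G\<close>-neighbours on \<open>C\<close>, which yields a path on \<open>2m + 1\<close> vertices in \<open>G\<close>. The disjoint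
  union of complete graphs on \<open>n - 1\<close> and \<open>m - 1\<close> vertices gives the lower bound.\<close>

section \<open>Paths and cycles as lists of vertices\<close>

definition is_path :: "('a \<Rightarrow> 'a \<Rightarrow> bool) \<Rightarrow> 'a list \<Rightarrow> bool" where
  "is_path E xs \<longleftrightarrow> distinct xs \<and> successively E xs"

definition is_cycle :: "('a \<Rightarrow> 'a \<Rightarrow> bool) \<Rightarrow> 'a list \<Rightarrow> bool" where
  "is_cycle E xs \<longleftrightarrow> xs \<noteq> [] \<and> is_path E xs \<and> E (last xs) (hd xs)"

lemma is_path_take: "is_path E xs \<Longrightarrow> is_path E (take j xs)"
  unfolding is_path_def
  by (metis append_take_drop_id distinct_take successively_append_iff)

lemma is_path_clique:
  assumes "distinct xs" and "\<And>x y. x \<in> set xs \<Longrightarrow> y \<in> set xs \<Longrightarrow> x \<noteq> y \<Longrightarrow> E x y"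
  shows "is_path E xs"
  using assms unfolding is_path_def
  by (induction xs) (use hd_in_set in \<open>fastforce simp: successively_Cons\<close>)+

section \<open>Depth-first search and a first long cycle\<close>

text \<open>The state after \<open>d\<close> steps of depth-first search: \<open>p\<close> is the
  stack with its top at the head, \<open>A\<close> the unvisited and \<open>B\<close> the finished
  vertices. A step pushes a vertex of \<open>A\<close> adjacent to the top or, if there is none,
  moves the top to \<open>B\<close>. Either move raises \<open>card B - card A\<close> by one, and
  the second keeps \<open>A\<close> and \<open>B\<close> free of edges between them.\<close>

lemma dfs_split:
  fixes V :: "'a set"
  assumes fin: "finite V"
    and "d \<le> card V"
  shows "\<exists>p A B. is_path E p \<and> set p \<union> A \<union> B = V \<and> set p \<inter> A = {} \<and> set p \<inter> B = {} \<and>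
    A \<inter> B = {} \<and> (\<forall>a\<in>A. \<forall>b\<in>B. \<not> E a b) \<and> card A + d = card V + card B"
  using assms(2)
proof (induction d)
  case 0
  show ?case
    by (rule exI[of _ "[]"], rule exI[of _ V], rule exI[of _ "{}"]) (simp add: is_path_def)
next
  case (Suc d)
  then obtain p A B where st: "is_path E p" "set p \<union> A \<union> B = V" "set p \<inter> A = {}" "set p \<inter> B = {}"
      "A \<inter> B = {}" "\<forall>a\<in>A. \<forall>b\<in>B. \<not> E a b" and c: "card A + d = card V + card B"
    by auto
  have finA: "finite A" and finB: "finite B"
    using st(2) fin by (auto intro: finite_subset)
  \<comment> \<open>Since \<open>Suc d \<le> card V\<close>, the count leaves an unvisited vertex,
    so an empty stack can be restarted.\<close>
  have "A \<noteq> {}" using c Suc.prems by auto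
  have push: ?case if y: "y \<in> A" "is_path E (y # p)" for y
  proof (rule exI[of _ "y # p"], rule exI[of _ "A - {y}"], rule exI[of _ B], intro conjI)
    have "card A > 0" using y(1) finA card_gt_0_iff by blast
    then show "card (A - {y}) + Suc d = card V + card B"
      using y(1) finA c by (simp add: card_Diff_singleton)
  qed (use st y in auto)
  show ?case
  proof (cases p)
    case Nil
    then show ?thesis using push \<open>A \<noteq> {}\<close> by (auto simp: is_path_def)
  next
    case (Cons h q)
    show ?thesis
    proof (cases "\<exists>y\<in>A. E y h")
      case True
      then obtain y where "y \<in> A" "E y h" by blast
      moreover from this have "is_path E (y # p)" using st(1,3) Cons by (auto simp: is_path_def)
      ultimately show ?thesis using push by blast
    next
      case False
      have "h \<notin> set q" "is_path E q"
        using st(1) Cons by (auto simp: is_path_def successively_Cons)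
      moreover have "card (insert h B) = Suc (card B)"
        using st(4) Cons finB by auto
      ultimately show ?thesis
        using st c Cons False
        by (intro exI[of _ q] exI[of _ A] exI[of _ "insert h B"] conjI) auto
    qed
  qed
qed

lemma set_splice: "set (splice xs ys) = set xs \<union> set ys"
  by (induction xs ys rule: splice.induct) auto

lemma is_cycle_splice:
  assumes "length as = length bs" "as \<noteq> []" "distinct as" "distinct bs" "set as \<inter> set bs = {}"
    and F: "\<And>a b. a \<in> set as \<Longrightarrow> b \<in> set bs \<Longrightarrow> F a b \<and> F b a"
  shows "is_cycle F (splice as bs)"
proof -
  \<comment> \<open>Knowing on which side the alternating list starts and ends lets the induction
    prepend a pair, and afterwards closes the cycle.\<close>
  have "successively F (splice as bs) \<and> distinct (splice as bs) \<and>
      hd (splice as bs) \<in> set as \<and> last (splice as bs) \<in> set bs"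
    using assms
  proof (induction as bs rule: list_induct2)
    case Nil
    then show ?case by simp
  next
    case (Cons a as b bs)
    show ?case
    proof (cases "as = []")
      case True
      then show ?thesis using Cons by auto
    next
      case False
      then have ih: "successively F (splice as bs)" "distinct (splice as bs)"
          "hd (splice as bs) \<in> set as" "last (splice as bs) \<in> set bs"
        using Cons.IH Cons.prems by auto
      have ne: "splice as bs \<noteq> []" using False by (cases as; cases bs) auto
      have "F b (hd (splice as bs))" using Cons.prems(5) ih(3) by auto
      then show ?thesis
        using ih ne Cons.prems by (auto simp: successively_Cons set_splice)
    qed
  qed
  moreover have "splice as bs \<noteq> []" using assms(2) by (cases as; cases bs) auto
  ultimately show ?thesis
    using F by (auto simp: is_cycle_def is_path_def)
qed

text \<open>After \<open>card V\<close> steps of the search \<open>A\<close> and \<open>B\<close>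
  have equal size. The stack has fewer than \<open>k\<close> vertices, so each of them has at least
  \<open>t\<close>, and alternating between \<open>t\<close> vertices of each closes up to a
  cycle.\<close>

lemma long_cycle_in_complement:
  assumes fin: "finite V" and sym: "symp E"
    and nopath: "\<And>xs. is_path E xs \<Longrightarrow> set xs \<subseteq> V \<Longrightarrow> length xs < k"
    and t: "t > 0" "2 * t + k \<le> card V + 1"
  shows "\<exists>xs. is_cycle (\<lambda>x y. \<not> E x y) xs \<and> set xs \<subseteq> V \<and> length xs = 2 * t"
proof -
  obtain p A B where st: "is_path E p" "set p \<union> A \<union> B = V" "set p \<inter> A = {}" "set p \<inter> B = {}"
      "A \<inter> B = {}" "\<forall>a\<in>A. \<forall>b\<in>B. \<not> E a b" and c: "card A + card V = card V + card B"
    using dfs_split[OF fin order_refl, where E = E] by blast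
  have finAB: "finite A" "finite B" using st(2) fin by (auto intro: finite_subset)
  have "card (set p \<union> A \<union> B) = card (set p) + card A + card B"
    using st(3-5) finAB by (subst card_Un_disjoint; auto simp: card_Un_disjoint)
  then have "card V = length p + card A + card B"
    using st(1,2) by (simp add: distinct_card is_path_def)
  moreover have "length p < k" using nopath st(1,2) by auto
  ultimately have "t \<le> card A" "t \<le> card B" using c t by auto
  then obtain A' B' where "A' \<subseteq> A" "card A' = t" "B' \<subseteq> B" "card B' = t" "finite A'" "finite B'"
    by (meson obtain_subset_with_card_n)
  moreover from this obtain as bs where "set as = A'" "distinct as" "set bs = B'" "distinct bs"
    using finite_distinct_list by metis
  ultimately have ab: "set as \<subseteq> A" "set bs \<subseteq> B" "distinct as" "distinct bs"
      "length as = t" "length bs = t"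
    by (auto dest: distinct_card)
  have "\<not> E a b \<and> \<not> E b a" if "a \<in> set as" "b \<in> set bs" for a b
    using that ab(1,2) st(6) sympD[OF sym] by blast
  then have "is_cycle (\<lambda>x y. \<not> E x y) (splice as bs)"
    using ab st(5) t(1) by (intro is_cycle_splice) auto
  moreover have "set (splice as bs) \<subseteq> V" using ab st(2) by (auto simp: set_splice)
  ultimately show ?thesis using ab by (intro exI[of _ "splice as bs"]) auto
qed

section \<open>Lengthening a cycle by one vertex\<close>

lemma cycle_insert_vertex:
  assumes "is_cycle F xs" "v \<notin> set xs" and sym: "symp F"
    and i: "i < length xs" "F v (xs ! i)" "F v (xs ! (Suc i mod length xs))"
  shows "\<exists>ys. is_cycle F ys \<and> set ys = insert v (set xs) \<and> length ys = Suc (length xs)"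
proof (cases "Suc i < length xs")
  case True
  let ?S = "take (Suc i) xs" and ?T = "drop (Suc i) xs"
  have split: "xs = ?S @ ?T" by simp
  have ends: "last ?S = xs ! i" "hd ?T = xs ! Suc i" "?S \<noteq> []" "?T \<noteq> []"
    using True by (auto simp: take_Suc_conv_app_nth hd_drop_conv_nth)
  obtain S T where ST: "?S = S" "?T = T" by simp
  have "is_cycle F (S @ v # T)"
    using assms(1,2) True i ends sympD[OF sym i(2)] split unfolding ST
    by (auto simp: is_cycle_def is_path_def successively_append_iff successively_Cons)
  then show ?thesis
    using split unfolding ST by (intro exI[of _ "S @ v # T"]) auto
next
  case False
  \<comment> \<open>The two neighbours are now the last and the first entry, so \<open>v\<close> is
    appended at the end.\<close>
  then have "Suc i = length xs" using i(1) by simp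
  moreover from this have "xs \<noteq> []" by auto
  ultimately have "last xs = xs ! i" "hd xs = xs ! (Suc i mod length xs)"
    by (simp_all add: last_conv_nth hd_conv_nth flip: \<open>Suc i = length xs\<close>)
  then have "F v (last xs)" "F v (hd xs)" using i by simp_all
  then have "is_cycle F (xs @ [v])"
    using assms(1,2) sympD[OF sym \<open>F v (last xs)\<close>]
    by (auto simp: is_cycle_def is_path_def successively_append_iff)
  then show ?thesis by (intro exI[of _ "xs @ [v]"]) auto
qed

text \<open>Write \<open>xs\<close> as \<open>T1 @ S @ T2\<close>, cut after positions
  \<open>i\<close> and \<open>j\<close>. The new cycle goes from \<open>v\<close> to position
  \<open>j\<close>, back along \<open>S\<close> to \<open>Suc i\<close>, over the chord to the
  successor of \<open>j\<close>, and on through \<open>T2\<close> and \<open>T1\<close> to position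
  \<open>i\<close>, which is joined to \<open>v\<close>.\<close>

lemma cycle_rotate_insert_vertex:
  assumes "is_cycle F xs" "v \<notin> set xs" and sym: "symp F"
    and ij: "i < j" "j < length xs" "F v (xs ! i)" "F v (xs ! j)"
      "F (xs ! Suc i) (xs ! (Suc j mod length xs))"
  shows "\<exists>ys. is_cycle F ys \<and> set ys = insert v (set xs) \<and> length ys = Suc (length xs)"
proof -
  define T1 where "T1 = take (Suc i) xs"
  define S where "S = drop (Suc i) (take (Suc j) xs)"
  define T2 where "T2 = drop (Suc j) xs"
  have "take (Suc j) xs = T1 @ S"
    using ij append_take_drop_id[of "Suc i" "take (Suc j) xs"]
    by (simp add: T1_def S_def min_def)
  then have xs: "xs = T1 @ S @ T2"
    unfolding T2_def by (metis append.assoc append_take_drop_id)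
  have ne: "T1 \<noteq> []" "S \<noteq> []" using ij by (auto simp: T1_def S_def)
  have "hd S = take (Suc j) xs ! Suc i" "last S = last (take (Suc j) xs)"
    unfolding S_def using ij by (simp_all only: hd_drop_conv_nth last_drop length_take)
  moreover have "take (Suc j) xs ! Suc i = xs ! Suc i" using ij by (intro nth_take) simp
  moreover have "last (take (Suc j) xs) = xs ! j" using ij by (simp add: take_Suc_conv_app_nth)
  moreover have "last T1 = xs ! i" using ij by (simp add: T1_def take_Suc_conv_app_nth)
  ultimately have hdlast: "last T1 = xs ! i" "hd S = xs ! Suc i" "last S = xs ! j"
    by simp_all
  \<comment> \<open>If \<open>j\<close> is the last position, \<open>T2\<close> is empty and the
    successor of \<open>j\<close> is the head of \<open>T1\<close>.\<close>
  have hdT: "hd (T2 @ T1) = xs ! (Suc j mod length xs)"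
  proof (cases "Suc j < length xs")
    case True
    then show ?thesis by (simp add: T2_def hd_append hd_drop_conv_nth)
  next
    case False
    then have "Suc j = length xs" using ij by simp
    moreover have "xs \<noteq> []" using ij by auto
    ultimately show ?thesis by (simp add: T1_def T2_def hd_conv_nth)
  qed
  have symF: "(\<lambda>x y. F y x) = F" using sympD[OF sym] by (intro ext) blast
  have c: "is_cycle F (T1 @ S @ T2)" using assms(1) xs by simp
  \<comment> \<open>The closing edge of the old cycle joins \<open>T2\<close> to
    \<open>T1\<close>.\<close>
  have TT: "successively F (T2 @ T1)"
    using c ne by (auto simp: is_cycle_def is_path_def successively_append_iff)
  have "successively F S"
    using c by (auto simp: is_cycle_def is_path_def successively_append_iff)
  then have "successively F (rev S)" by (simp only: successively_rev symF)
  then have "successively F (v # rev S @ T2 @ T1)"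
    using TT ne hdlast hdT ij
    by (simp add: successively_Cons successively_append_iff[of _ "rev S"] hd_append hd_rev last_rev)
  moreover have "distinct (v # rev S @ T2 @ T1)"
    using c assms(2) xs by (auto simp: is_cycle_def is_path_def)
  moreover have "F (last (v # rev S @ T2 @ T1)) v"
    using ne hdlast sympD[OF sym ij(3)] by simp
  ultimately have "is_cycle F (v # rev S @ T2 @ T1)"
    by (simp add: is_cycle_def is_path_def)
  then show ?thesis
    using xs by (intro exI[of _ "v # rev S @ T2 @ T1"]) auto
qed

lemma few_neighbours_on_cycle:
  assumes sym: "symp E"
    and nopath: "\<And>xs. is_path E xs \<Longrightarrow> set xs \<subseteq> V \<Longrightarrow> length xs < k"
    and cyc: "is_cycle (\<lambda>x y. \<not> E x y) xs" "set xs \<subseteq> V" and v: "v \<in> V - set xs"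
    and noext: "\<nexists>ys. is_cycle (\<lambda>x y. \<not> E x y) ys \<and> set ys \<subseteq> V \<and> length ys = Suc (length xs)"
  shows "card {y \<in> set xs. \<not> E v y} + 2 \<le> k"
proof -
  let ?F = "\<lambda>x y. \<not> E x y"
  let ?l = "length xs"
  have symF: "symp ?F" using sym by (simp add: symp_def) blast
  have dist: "distinct xs" and ne: "xs \<noteq> []" using cyc by (auto simp: is_cycle_def is_path_def)
  have noext': "\<nexists>ys. is_cycle ?F ys \<and> set ys = insert v (set xs) \<and> length ys = Suc ?l"
    using noext cyc(2) v by (metis DiffD1 insert_subset)
  define I where "I = {i. i < ?l \<and> ?F v (xs ! i)}"
  define g where "g i = xs ! (Suc i mod ?l)" for i
  have modlt: "Suc i mod ?l < ?l" for i using ne by simp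
  have E1: "E v (g i)" if "i \<in> I" for i
  proof (rule ccontr)
    assume "\<not> E v (g i)"
    then have "\<exists>ys. is_cycle ?F ys \<and> set ys = insert v (set xs) \<and> length ys = Suc ?l"
      using v that by (intro cycle_insert_vertex[OF cyc(1) _ symF, of v i]) (simp_all add: I_def g_def)
    then show False using noext' by simp
  qed
  have E2: "E (g i) (g j)" if "i \<in> I" "j \<in> I" "i < j" for i j
  proof (rule ccontr)
    assume "\<not> E (g i) (g j)"
    moreover have "Suc i mod ?l = Suc i" using that by (simp add: I_def)
    ultimately have "\<exists>ys. is_cycle ?F ys \<and> set ys = insert v (set xs) \<and> length ys = Suc ?l"
      using v that
      by (intro cycle_rotate_insert_vertex[OF cyc(1) _ symF that(3)]) (simp_all add: I_def g_def)
    then show False using noext' by simp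
  qed
  have inj: "inj_on g I"
  proof (rule inj_onI)
    fix i j assume "i \<in> I" "j \<in> I" "g i = g j"
    then have "Suc i mod ?l = Suc j mod ?l"
      using dist modlt by (simp add: g_def nth_eq_iff_index_eq)
    then show "i = j"
      using \<open>i \<in> I\<close> \<open>j \<in> I\<close> unfolding I_def
      by (auto simp: mod_Suc split: if_splits)
  qed
  have finI: "finite I" by (simp add: I_def)
  obtain zs where zs: "set zs = g ` I" "distinct zs" using finite_distinct_list[of "g ` I"] finI by auto
  have gxs: "g i \<in> set xs" for i using modlt by (simp add: g_def)
  have "is_path E (v # zs)"
  proof (rule is_path_clique)
    show "distinct (v # zs)" using zs v gxs by auto
    fix x y assume "x \<in> set (v # zs)" "y \<in> set (v # zs)" "x \<noteq> y"
    then consider "x = v" "y \<in> g ` I" | "y = v" "x \<in> g ` I" | "x \<in> g ` I" "y \<in> g ` I"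
      using zs by auto
    then show "E x y"
    proof cases
      case 3
      then obtain i j where "i \<in> I" "j \<in> I" "x = g i" "y = g j" by auto
      then show ?thesis
        using E2[of i j] E2[of j i] sympD[OF sym] \<open>x \<noteq> y\<close> by (metis linorder_neqE_nat)
    qed (use E1 sympD[OF sym] in blast)+
  qed
  moreover have "set (v # zs) \<subseteq> V" using zs(1) gxs cyc(2) v by auto
  ultimately have "length (v # zs) < k" by (rule nopath)
  moreover have "length zs = card I"
    using distinct_card[OF zs(2)] card_image[OF inj] zs(1) by simp
  moreover have "card {y \<in> set xs. \<not> E v y} = card I"
  proof -
    have "inj_on ((!) xs) I" using dist by (simp add: I_def inj_on_def nth_eq_iff_index_eq)
    moreover have "(!) xs ` I = {y \<in> set xs. \<not> E v y}" by (auto simp: I_def in_set_conv_nth)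
    ultimately show ?thesis by (metis card_image)
  qed
  ultimately show ?thesis by simp
qed

section \<open>Cycles of every length up to \<open>n\<close>\<close>

text \<open>Greedy choice: the path alternates between \<open>vs\<close> and \<open>C\<close>,
  ending in \<open>C\<close>, and is built from its far end. Fixing its start as
  \<open>hd vs\<close> allows the next vertex to be attached through a fresh common
  neighbour.\<close>

lemma path_through_common_neighbours:
  assumes "finite C" "vs \<noteq> []" "distinct vs" "set vs \<inter> C = {}" "length vs \<le> M"
    and sym: "symp E"
    and common: "\<And>v w. v \<in> set vs \<Longrightarrow> w \<in> set vs \<Longrightarrow> card {y \<in> C. E v y \<and> E w y} > M"
  shows "\<exists>q. is_path E (hd vs # q) \<and> set q \<subseteq> set vs \<union> C \<and> length q + 1 = 2 * length vs \<and>
    card (set q \<inter> C) = length vs"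
  using assms(2-5) common
proof (induction vs rule: list_nonempty_induct)
  case (single v)
  have "{y \<in> C. E v y \<and> E v y} \<noteq> {}"
    using single(4)[of v v] by (auto simp del: Collect_empty_eq)
  then obtain y where "y \<in> C" "E v y" by auto
  then show ?case
    using single(2) by (intro exI[of _ "[y]"]) (auto simp: is_path_def)
next
  case (cons v vs)
  have "\<exists>q. is_path E (hd vs # q) \<and> set q \<subseteq> set vs \<union> C \<and> length q + 1 = 2 * length vs \<and>
    card (set q \<inter> C) = length vs"
  proof (rule cons.IH)
    show "card {y \<in> C. E a y \<and> E b y} > M" if "a \<in> set vs" "b \<in> set vs" for a b
      using cons.prems(4) that by simp
  qed (use cons.prems(1-3) in auto)
  then obtain q where q: "is_path E (hd vs # q)" "set q \<subseteq> set vs \<union> C" "length q + 1 = 2 * length vs"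
      "card (set q \<inter> C) = length vs"
    by blast
  have hdin: "hd vs \<in> set vs" using cons.hyps by simp
  \<comment> \<open>Fewer than \<open>M\<close> vertices of \<open>C\<close> have been used, so some
    common neighbour is still free.\<close>
  have "card (set q \<inter> C) < card {y \<in> C. E v y \<and> E (hd vs) y}"
    using q(4) cons.prems(3) cons.prems(4)[of v "hd vs"] hdin by simp
  then have "\<not> {y \<in> C. E v y \<and> E (hd vs) y} \<subseteq> set q \<inter> C"
    using card_mono[of "set q \<inter> C"] by (meson List.finite_set finite_Int leD)
  then obtain y where y: "y \<in> C" "E v y" "E (hd vs) y" "y \<notin> set q" by blast
  have "is_path E (v # y # hd vs # q)"
    using q(1,2) y cons.prems(1,2) hdin sympD[OF sym y(3)] by (auto simp: is_path_def)
  moreover have "set (y # hd vs # q) \<inter> C = insert y (set q \<inter> C)"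
    using y(1) cons.prems(2) hdin by auto
  ultimately show ?case
    using q(2-4) y hdin by (intro exI[of _ "y # hd vs # q"]) auto
qed

lemma cycle_extend:
  assumes fin: "finite V" and sym: "symp E"
    and nopath: "\<And>xs. is_path E xs \<Longrightarrow> set xs \<subseteq> V \<Longrightarrow> length xs < k"
    and k: "k \<ge> 2"
    and cyc: "is_cycle (\<lambda>x y. \<not> E x y) xs" "set xs \<subseteq> V"
    and len: "2 * k + k div 2 \<le> length xs + 3" "length xs + k div 2 \<le> card V"
  shows "\<exists>ys. is_cycle (\<lambda>x y. \<not> E x y) ys \<and> set ys \<subseteq> V \<and> length ys = Suc (length xs)"
proof (rule ccontr)
  assume noext: "\<not> ?thesis"
  let ?C = "set xs" and ?m = "k div 2"
  have few: "card {y \<in> ?C. \<not> E v y} + 2 \<le> k" if "v \<in> V - ?C" for v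
    using few_neighbours_on_cycle[OF sym nopath cyc that noext] by blast
  have cardC: "card ?C = length xs"
    using cyc(1) by (simp add: is_cycle_def is_path_def distinct_card)
  have "?m \<le> card (V - ?C)"
    using len(2) cardC cyc(2) by (simp add: card_Diff_subset)
  then obtain W where W: "W \<subseteq> V - ?C" "card W = ?m" "finite W"
    by (meson obtain_subset_with_card_n)
  then obtain vs where vs: "set vs = W" "distinct vs" using finite_distinct_list by blast
  then have lenvs: "length vs = ?m" using W(2) distinct_card by fastforce
  \<comment> \<open>Each of \<open>v\<close> and \<open>w\<close> misses at most
    \<open>k - 2\<close> vertices of the cycle, so at least \<open>length xs - 2 * (k - 2)\<close>
    are common neighbours; the first bound in \<open>len\<close> makes this exceed
    \<open>?m\<close>.\<close>
  have common: "card {y \<in> ?C. E v y \<and> E w y} > ?m" if "v \<in> set vs" "w \<in> set vs" for v w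
  proof -
    have "?C = {y \<in> ?C. E v y \<and> E w y} \<union> ({y \<in> ?C. \<not> E v y} \<union> {y \<in> ?C. \<not> E w y})" by auto
    then have "card ?C \<le> card {y \<in> ?C. E v y \<and> E w y} + (card {y \<in> ?C. \<not> E v y} + card {y \<in> ?C. \<not> E w y})"
      by (metis (no_types, lifting) add_left_mono card_Un_le le_trans)
    moreover have "v \<in> V - ?C" "w \<in> V - ?C" using that vs W by auto
    ultimately show ?thesis using few[of v] few[of w] len(1) cardC by linarith
  qed
  have "vs \<noteq> []" using lenvs k by auto
  then obtain q where q: "is_path E (hd vs # q)" "set q \<subseteq> set vs \<union> ?C" "length q + 1 = 2 * ?m"
      "card (set q \<inter> ?C) = ?m"
    using path_through_common_neighbours[of ?C vs ?m E] vs W lenvs sym common by auto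
  have hdin: "hd vs \<in> W" using \<open>vs \<noteq> []\<close> vs by auto
  \<comment> \<open>The path so far has \<open>2 * ?m\<close> vertices, one too few when
    \<open>k\<close> is odd. A further vertex of the cycle is put in front of
    \<open>hd vs\<close>.\<close>
  have "card (set q \<inter> ?C) < card {y \<in> ?C. E (hd vs) y \<and> E (hd vs) y}"
    using q(4) common[of "hd vs" "hd vs"] hdin vs by simp
  then have "\<not> {y \<in> ?C. E (hd vs) y \<and> E (hd vs) y} \<subseteq> set q \<inter> ?C"
    using card_mono[of "set q \<inter> ?C"] by (meson List.finite_set finite_Int leD)
  then obtain y where y: "y \<in> ?C" "E (hd vs) y" "y \<notin> set q" by blast
  have "is_path E (y # hd vs # q)"
    using q(1) y hdin W sympD[OF sym y(2)] by (auto simp: is_path_def)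
  moreover have "set (y # hd vs # q) \<subseteq> V" using q(2) y hdin W vs cyc(2) by auto
  ultimately have "length (y # hd vs # q) < k" by (rule nopath)
  then show False using q(3) by simp
qed

lemma cycle_of_length:
  assumes fin: "finite V" and sym: "symp E"
    and nopath: "\<And>xs. is_path E xs \<Longrightarrow> set xs \<subseteq> V \<Longrightarrow> length xs < k"
    and k: "k \<ge> 2" and n: "n \<ge> 3 * k" and V: "card V = n + k div 2 - 1"
  shows "\<exists>xs. is_cycle (\<lambda>x y. \<not> E x y) xs \<and> set xs \<subseteq> V \<and> length xs = n"
proof -
  let ?P = "\<lambda>l. \<exists>xs. is_cycle (\<lambda>x y. \<not> E x y) xs \<and> set xs \<subseteq> V \<and> length xs = l"
  \<comment> \<open>The largest \<open>t\<close> that \<open>long_cycle_in_complement\<close>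
    permits.\<close>
  define t where "t = (card V + 1 - k) div 2"
  have t: "t > 0" "2 * t + k \<le> card V + 1" "2 * t \<le> n" "2 * k + k div 2 \<le> 2 * t + 1"
  proof -
    have "2 * t \<le> card V + 1 - k" "card V + 1 - k \<le> 2 * t + 1" "2 * (k div 2) \<le> k"
      unfolding t_def by linarith+
    \<comment> \<open>Here \<open>n \<ge> 3 * k\<close> enters: \<open>2 * t + 1\<close> is at least
      \<open>n + k div 2 - k\<close>, hence at least \<open>2 * k + k div 2\<close>.\<close>
    then show "t > 0" "2 * t + k \<le> card V + 1" "2 * t \<le> n" "2 * k + k div 2 \<le> 2 * t + 1"
      using k n V by linarith+
  qed
  have "?P (2 * t)" by (rule long_cycle_in_complement[OF fin sym nopath t(1,2)])
  have "?P l" if "2 * t \<le> l" "l \<le> n" for l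
    using that
  proof (induction l rule: dec_induct)
    case base
    show ?case by fact
  next
    case (step l)
    then obtain xs where xs: "is_cycle (\<lambda>x y. \<not> E x y) xs" "set xs \<subseteq> V" "length xs = l" by auto
    \<comment> \<open>As \<open>l < n\<close>, at least \<open>k div 2\<close> vertices lie outside
      the cycle.\<close>
    have len: "2 * k + k div 2 \<le> length xs + 3" "length xs + k div 2 \<le> card V"
      using xs(3) step t V k by linarith+
    have "?P (Suc (length xs))" by (rule cycle_extend[OF fin sym nopath k xs(1,2) len])
    then show ?case by (simp only: xs(3))
  qed
  then show ?thesis using t(3) by blast
qed

section \<open>Transfer to graph copies and the upper bound\<close>

definition arrows :: "nat \<Rightarrow> 'a graph \<Rightarrow> 'b graph \<Rightarrow> bool" where
  "arrows N H1 H2 \<longleftrightarrow> (\<forall>\<Gamma> :: nat graph. finite_simple_graph \<Gamma> \<and> card (fst \<Gamma>) = N \<longrightarrow>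
     contains_copy \<Gamma> H1 \<or> contains_copy (complement \<Gamma>) H2)"

lemma contains_copy_path_graph:
  assumes "is_path (\<lambda>x y. {x, y} \<in> snd G) xs" "set xs \<subseteq> fst G" "length xs = k"
  shows "contains_copy G (path_graph k)"
  unfolding contains_copy_def
proof (intro exI conjI)
  have d: "distinct xs" and s: "successively (\<lambda>x y. {x, y} \<in> snd G) xs"
    using assms(1) by (auto simp: is_path_def)
  show "inj_on ((!) xs) (fst (path_graph k))"
    using d assms(3) by (simp add: path_graph_def inj_on_def nth_eq_iff_index_eq)
  show "(!) xs ` fst (path_graph k) \<subseteq> fst G" using assms(2,3) by (auto simp: path_graph_def)
  show "\<forall>e\<in>snd (path_graph k). (!) xs ` e \<in> snd G"
    using s assms(3) by (auto simp: path_graph_def successively_conv_nth)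
qed

lemma contains_copy_cycle_graph:
  assumes "is_cycle (\<lambda>x y. {x, y} \<in> snd G) xs" "set xs \<subseteq> fst G" "length xs = n"
  shows "contains_copy G (cycle_graph n)"
  unfolding contains_copy_def
proof (intro exI conjI)
  have d: "distinct xs" and s: "successively (\<lambda>x y. {x, y} \<in> snd G) xs"
    and ne: "xs \<noteq> []" and l: "{last xs, hd xs} \<in> snd G"
    using assms(1) by (auto simp: is_path_def is_cycle_def)
  show "inj_on ((!) xs) (fst (cycle_graph n))"
    using d assms(3) by (simp add: cycle_graph_def inj_on_def nth_eq_iff_index_eq)
  show "(!) xs ` fst (cycle_graph n) \<subseteq> fst G" using assms(2,3) by (auto simp: cycle_graph_def)
  have "{xs ! i, xs ! (Suc i mod n)} \<in> snd G" if "i < n" for i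
  proof (cases "Suc i < n")
    case True
    then show ?thesis using s assms(3) by (auto simp: successively_conv_nth)
  next
    case False
    then have "Suc i = n" using that by simp
    then have "last xs = xs ! i" "hd xs = xs ! (Suc i mod n)"
      using ne assms(3) by (auto simp: last_conv_nth hd_conv_nth)
    then show ?thesis using l by simp
  qed
  then show "\<forall>e\<in>snd (cycle_graph n). (!) xs ` e \<in> snd G"
    by (auto simp: cycle_graph_def)
qed

lemma contains_copy_path_graphD:
  assumes "contains_copy G (path_graph m)"
  shows "\<exists>f. inj_on f {..<m} \<and> f ` {..<m} \<subseteq> fst G \<and> (\<forall>i. Suc i < m \<longrightarrow> {f i, f (Suc i)} \<in> snd G)"
proof -
  obtain f where f: "inj_on f (fst (path_graph m))" "f ` fst (path_graph m) \<subseteq> fst G"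
      "\<forall>e \<in> snd (path_graph m). f ` e \<in> snd G"
    using assms unfolding contains_copy_def by (elim exE conjE)
  have "{f i, f (Suc i)} \<in> snd G" if "Suc i < m" for i
  proof -
    have "{i, Suc i} \<in> snd (path_graph m)" using that by (auto simp: path_graph_def)
    then show ?thesis using f(3) by fastforce
  qed
  then show ?thesis using f(1,2) by (intro exI[of _ f]) (simp add: path_graph_def)
qed

lemma contains_path_if_contains_cycle:
  assumes "contains_copy G (cycle_graph n)"
  shows "contains_copy G (path_graph n)"
proof -
  have "snd (path_graph n) \<subseteq> snd (cycle_graph n)"
    by (force simp: path_graph_def cycle_graph_def)
  moreover have "fst (path_graph n) = fst (cycle_graph n)"
    by (simp add: path_graph_def cycle_graph_def)
  ultimately show ?thesis
    using assms unfolding contains_copy_def by (metis subsetD)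
qed

lemma arrows_cycle_path:
  assumes k: "k \<ge> 2" and n: "n \<ge> 3 * k"
  shows "arrows (n + k div 2 - 1) (cycle_graph n) (path_graph k)"
  unfolding arrows_def
proof (intro allI impI)
  fix \<Gamma> :: "nat graph"
  assume G: "finite_simple_graph \<Gamma> \<and> card (fst \<Gamma>) = n + k div 2 - 1"
  let ?E = "\<lambda>x y. {x, y} \<in> snd (complement \<Gamma>)"
  show "contains_copy \<Gamma> (cycle_graph n) \<or> contains_copy (complement \<Gamma>) (path_graph k)"
  proof (rule disjCI)
    assume no: "\<not> contains_copy (complement \<Gamma>) (path_graph k)"
    have nopath: "length xs < k" if "is_path ?E xs" "set xs \<subseteq> fst \<Gamma>" for xs
    proof (rule ccontr)
      assume "\<not> length xs < k"
      moreover have "set (take k xs) \<subseteq> fst (complement \<Gamma>)"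
        using that(2) set_take_subset by (fastforce simp: complement_def)
      ultimately show False
        using no contains_copy_path_graph[OF is_path_take[OF that(1), of k]] by simp
    qed
    have "symp ?E" by (auto intro: sympI simp: insert_commute)
    then obtain xs where xs: "is_cycle (\<lambda>x y. \<not> ?E x y) xs" "set xs \<subseteq> fst \<Gamma>" "length xs = n"
      using cycle_of_length[of "fst \<Gamma>" ?E k n] G nopath k n
      by (auto simp: finite_simple_graph_def)
    \<comment> \<open>The negation of \<open>?E\<close> also holds for \<open>x = y\<close>, so it
      yields an edge of \<open>\<Gamma>\<close> only for distinct vertices. This is why
      \<open>hd xs \<noteq> last xs\<close> is needed for the closing edge.\<close>
    have edge: "{x, y} \<in> snd \<Gamma>" if "\<not> ?E x y" "x \<in> set xs" "y \<in> set xs" "x \<noteq> y" for x y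
      using that xs(2) by (auto simp: complement_def)
    have d: "distinct xs" using xs(1) by (simp add: is_cycle_def is_path_def)
    have s: "{xs ! i, xs ! Suc i} \<in> snd \<Gamma>" if "Suc i < length xs" for i
      using that xs(1) d
      by (intro edge) (auto simp: is_cycle_def is_path_def successively_conv_nth nth_eq_iff_index_eq)
    have "hd xs \<noteq> last xs"
      using d xs(3) k n by (cases xs) (auto split: if_splits)
    then have "{last xs, hd xs} \<in> snd \<Gamma>"
      using xs(1) by (intro edge) (auto simp: is_cycle_def)
    then have "is_cycle (\<lambda>x y. {x, y} \<in> snd \<Gamma>) xs"
      using s d xs(1) by (auto simp: is_cycle_def is_path_def successively_conv_nth)
    then show "contains_copy \<Gamma> (cycle_graph n)"
      using contains_copy_cycle_graph xs by blast
  qed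
qed

section \<open>The lower bound\<close>

text \<open>In the graph \<open>\<Gamma>\<close> below, the numbers under \<open>n - 1\<close> and
  the remaining ones, fewer than \<open>k div 2\<close>, form two cliques without edges between
  them. A path of \<open>\<Gamma>\<close> stays on one side and so has fewer than \<open>n\<close>
  vertices; in the complement, of any two consecutive vertices of a path at least one is on the
  small side.\<close>

lemma not_arrows_path_path:
  assumes k: "k \<ge> 2" and n: "n \<ge> k" and N: "N < n + k div 2 - 1"
  shows "\<not> arrows N (path_graph n) (path_graph k)"
proof -
  define \<Gamma> :: "nat graph" where
    "\<Gamma> = ({..<N}, {e \<in> nsets {..<N} 2. \<forall>x\<in>e. \<forall>y\<in>e. x < n - 1 \<longleftrightarrow> y < n - 1})"
  have "finite_simple_graph \<Gamma> \<and> card (fst \<Gamma>) = N"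
    by (auto simp: \<Gamma>_def finite_simple_graph_def)
  moreover have "\<not> contains_copy \<Gamma> (path_graph n)"
  proof
    assume "contains_copy \<Gamma> (path_graph n)"
    then obtain f where f: "inj_on f {..<n}" "f ` {..<n} \<subseteq> fst \<Gamma>"
        and e: "\<forall>i. Suc i < n \<longrightarrow> {f i, f (Suc i)} \<in> snd \<Gamma>"
      by (blast dest: contains_copy_path_graphD)
    have fN: "f ` {..<n} \<subseteq> {..<N}" using f(2) by (simp add: \<Gamma>_def)
    have same: "f i < n - 1 \<longleftrightarrow> f 0 < n - 1" if "i < n" for i
      using that
    proof (induction i)
      case (Suc i)
      have "f i < n - 1 \<longleftrightarrow> f (Suc i) < n - 1" 
      proof -
        have "{f i, f (Suc i)} \<in> snd \<Gamma>" using e Suc.prems by blast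
        then show ?thesis unfolding \<Gamma>_def snd_conv by blast
      qed
      then show ?case using Suc by simp
    qed simp
    have "f ` {..<n} \<subseteq> {..<n - 1} \<or> f ` {..<n} \<subseteq> {n - 1..<N}"
    proof (cases "f 0 < n - 1")
      case True
      then have "f ` {..<n} \<subseteq> {..<n - 1}" using same by blast
      then show ?thesis ..
    next
      case False
      then have "\<forall>i<n. n - 1 \<le> f i" using same not_less by blast
      then have "f ` {..<n} \<subseteq> {n - 1..<N}" using fN by fastforce
      then show ?thesis ..
    qed
    then have "card (f ` {..<n}) \<le> card {..<n - 1} \<or> card (f ` {..<n}) \<le> card {n - 1..<N}"
      by (meson card_mono finite_atLeastLessThan finite_lessThan)
    then show False using f(1) k n N by (auto simp: card_image)
  qed
  moreover have "\<not> contains_copy (complement \<Gamma>) (path_graph k)"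
  proof
    assume "contains_copy (complement \<Gamma>) (path_graph k)"
    then obtain f where f: "inj_on f {..<k}" "f ` {..<k} \<subseteq> fst (complement \<Gamma>)"
        and e: "\<forall>i. Suc i < k \<longrightarrow> {f i, f (Suc i)} \<in> snd (complement \<Gamma>)"
      by (blast dest: contains_copy_path_graphD)
    have fN: "f ` {..<k} \<subseteq> {..<N}" using f(2) by (simp add: \<Gamma>_def complement_def)
    have alt: "\<not> (f i < n - 1 \<and> f (Suc i) < n - 1)" if "Suc i < k" for i
    proof
      assume "f i < n - 1 \<and> f (Suc i) < n - 1"
      moreover have "{f i, f (Suc i)} \<in> snd (complement \<Gamma>)" using e that by blast
      ultimately show False by (auto simp: \<Gamma>_def complement_def)
    qed
    \<comment> \<open>From each pair of indices \<open>2 * i\<close>, \<open>2 * i + 1\<close>,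
      \<open>g\<close> selects one that \<open>f\<close> sends to the small side. The pairs are
      disjoint, so this needs \<open>k div 2\<close> vertices there.\<close>
    define g where "g i = (if f (2 * i) < n - 1 then 2 * i + 1 else 2 * i)" for i
    have gk: "g i < k" if "i < k div 2" for i using that by (auto simp: g_def)
    have "inj_on g {..<k div 2}"
    proof (rule inj_onI)
      fix i j assume "g i = g j"
      moreover have "g l div 2 = l" for l by (simp add: g_def)
      ultimately show "i = j" by metis
    qed
    then have "inj_on (f \<circ> g) {..<k div 2}"
      using f(1) gk by (auto intro!: comp_inj_on elim: inj_on_subset)
    moreover have "(f \<circ> g) ` {..<k div 2} \<subseteq> {n - 1..<N}"
    proof
      fix y assume "y \<in> (f \<circ> g) ` {..<k div 2}"
      then obtain i where i: "i < k div 2" "y = f (g i)" by auto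
      then have "y < N" using fN gk by auto
      moreover have "\<not> y < n - 1" using alt[of "2 * i"] i by (auto simp: g_def)
      ultimately show "y \<in> {n - 1..<N}" by simp
    qed
    ultimately have "card {..<k div 2} \<le> card {n - 1..<N}"
      by (rule card_inj_on_le) simp
    then show False using N k n by auto
  qed
  ultimately show ?thesis unfolding arrows_def by blast
qed

text \<open>This carries the upper bound from cycles to paths and, by contraposition, the lower
  bound from paths to cycles.\<close>

lemma arrows_path_if_arrows_cycle:
  "arrows N (cycle_graph n) H \<Longrightarrow> arrows N (path_graph n) H"
  unfolding arrows_def using contains_path_if_contains_cycle by blast

lemma ramsey_number_eqI:
  assumes "0 < N" "arrows N H1 H2" "\<And>M. M < N \<Longrightarrow> \<not> arrows M H1 H2"
  shows "ramsey_number H1 H2 = N"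
  unfolding ramsey_number_def arrows_def[symmetric]
  using assms by (intro Least_equality) (auto simp: not_less[symmetric])

theorem corollary1p5:
  fixes k n :: nat
  assumes "k \<ge> 2" and "n \<ge> 3 * k"
  shows "ramsey_number (path_graph n) (path_graph k) = ramsey_number (cycle_graph n) (path_graph k)
    \<and> ramsey_number (cycle_graph n) (path_graph k) = n + k div 2 - 1"
proof -
  let ?N = "n + k div 2 - 1"
  have pos: "0 < ?N" using assms by linarith
  have upper: "arrows ?N (cycle_graph n) (path_graph k)" by (rule arrows_cycle_path) fact+
  have lower: "\<not> arrows M (path_graph n) (path_graph k)" if "M < ?N" for M
    using not_arrows_path_path that assms by simp
  have "ramsey_number (path_graph n) (path_graph k) = ?N"
    using pos arrows_path_if_arrows_cycle[OF upper] lower by (rule ramsey_number_eqI)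
  moreover have "ramsey_number (cycle_graph n) (path_graph k) = ?N"
    using pos upper
    by (rule ramsey_number_eqI) (use lower arrows_path_if_arrows_cycle in blast)
  ultimately show ?thesis by simp
qed

end
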